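(* Let $G$ be a connected $P_5$-free chordal bipartite graph with bipartition $(A,B)$, let $(A_1,B_1)$ be a maximum biclique of $G$ with $A_1\subseteq A$, $B_1\subseteq B$, and let $A_2=A\setminus A_1=\{u_1,\dots,u_p\}$ and $B_2=B\setminus B_1=\{v_1,\dots,v_q\}$. If $d(u_1)\le d(u_2)\le\cdots\le d(u_p)$, then $N_G(u_1)\subseteq N_G(u_2)\subseteq\cdots\subseteq N_G(u_p)$. Further, if $d(v_1)\le d(v_2)\le\cdots\le d(v_q)$, then $N_G(v_1)\subseteq N_G(v_2)\subseteq\cdots\subseteq N_G(v_q)$.
   Context: Graphs are finite, simple and undirected. A bipartite graph is chordal bipartite if every cycle of length at least six has a chord. $G$ is $P_5$-free if it has no induced path on five vertices. $N_G(v)$ is the neighbourhood of $v$ and $d(v)=|N_G(v)|$. A biclique is a pair $(X,Y)$ with $X\subseteq A$, $Y\subseteq B$ such that every vertex of $X$ is adjacent to every vertex of $Y$; it is maximal if no vertex can be added to $X$ or to $Y$ keeping this property. Following the paper, a maximum biclique is a maximal biclique $(X,Y)$ for which $\bigl||X|-|Y|\bigr|$ is minimum. *)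

theory Defs
  imports Main "Graph_Theory.Graph_Theory"
begin

text \<open>
  Finite simple undirected graphs are the \<^locale>\<open>pair_graph\<close>s of the library: the arc set is a
  symmetric irreflexive relation, and the edge \<open>uv\<close> is the pair of arcs \<open>(u, v)\<close>, \<open>(v, u)\<close>.
\<close>

definition nbhd :: "'a pair_pre_digraph \<Rightarrow> 'a \<Rightarrow> 'a set" where
  "nbhd G v = {w \<in> pverts G. (v, w) \<in> parcs G}"

definition deg :: "'a pair_pre_digraph \<Rightarrow> 'a \<Rightarrow> nat" where
  "deg G v = card (nbhd G v)"

definition bipartition :: "'a pair_pre_digraph \<Rightarrow> 'a set \<Rightarrow> 'a set \<Rightarrow> bool" where
  "bipartition G A B \<longleftrightarrow> A \<union> B = pverts G \<and> A \<inter> B = {} \<and> parcs G \<subseteq> A \<times> B \<union> B \<times> A"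

text \<open>
  A cycle \<open>c\<close> is given by its list of arcs, so its vertices are the tails of these arcs. The
  library predicate \<^const>\<open>pre_digraph.cycle\<close> also admits the closed walks \<open>a, b, a\<close>, which are
  not cycles of an undirected graph; these have length two and are irrelevant below.
\<close>

definition has_chord :: "'a pair_pre_digraph \<Rightarrow> ('a \<times> 'a) awalk \<Rightarrow> bool" where
  "has_chord G c \<longleftrightarrow>
     (\<exists>x \<in> fst ` set c. \<exists>y \<in> fst ` set c. (x, y) \<in> parcs G \<and> (x, y) \<notin> set c \<and> (y, x) \<notin> set c)"

definition chordal_bipartite :: "'a pair_pre_digraph \<Rightarrow> bool" where
  "chordal_bipartite G \<longleftrightarrow>
     (\<exists>A B. bipartition G A B) \<and>
     (\<forall>c. pre_digraph.cycle (with_proj G) c \<and> length c \<ge> 6 \<longrightarrow> has_chord G c)"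

definition induced_path :: "'a pair_pre_digraph \<Rightarrow> 'a vwalk \<Rightarrow> bool" where
  "induced_path G p \<longleftrightarrow> vpath p (with_proj G) \<and>
     (\<forall>x \<in> set p. \<forall>y \<in> set p. (x, y) \<in> parcs G \<longrightarrow>
        (x, y) \<in> set (vwalk_arcs p) \<or> (y, x) \<in> set (vwalk_arcs p))"

definition P5_free :: "'a pair_pre_digraph \<Rightarrow> bool" where
  "P5_free G \<longleftrightarrow> \<not> (\<exists>p. induced_path G p \<and> length p = 5)"

definition biclique ::
  "'a pair_pre_digraph \<Rightarrow> 'a set \<Rightarrow> 'a set \<Rightarrow> 'a set \<Rightarrow> 'a set \<Rightarrow> bool" where
  "biclique G A B X Y \<longleftrightarrow> X \<subseteq> A \<and> Y \<subseteq> B \<and> (\<forall>x \<in> X. \<forall>y \<in> Y. (x, y) \<in> parcs G)"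

definition maximal_biclique ::
  "'a pair_pre_digraph \<Rightarrow> 'a set \<Rightarrow> 'a set \<Rightarrow> 'a set \<Rightarrow> 'a set \<Rightarrow> bool" where
  "maximal_biclique G A B X Y \<longleftrightarrow> biclique G A B X Y \<and>
     (\<forall>a. a \<notin> X \<longrightarrow> \<not> biclique G A B (insert a X) Y) \<and>
     (\<forall>b. b \<notin> Y \<longrightarrow> \<not> biclique G A B X (insert b Y))"

text \<open>
  \<open>Maximum\<close> refers to balance, not to size: among the maximal bicliques, the difference of the
  cardinalities of the two sides is minimum.
\<close>

definition maximum_biclique ::
  "'a pair_pre_digraph \<Rightarrow> 'a set \<Rightarrow> 'a set \<Rightarrow> 'a set \<Rightarrow> 'a set \<Rightarrow> bool" where
  "maximum_biclique G A B X Y \<longleftrightarrow> maximal_biclique G A B X Y \<and>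
     (\<forall>X' Y'. maximal_biclique G A B X' Y' \<longrightarrow>
        \<bar>int (card X) - int (card Y)\<bar> \<le> \<bar>int (card X') - int (card Y')\<bar>)"

end

theory Submission
  imports Defs
begin

text \<open>
  In a connected \<open>P\<^sub>5\<close>-free bipartite graph, two vertices of the same part have a common neighbour
  \<open>c\<close>, unless one of them is isolated: extending a walk from one of them never leaves distance
  three, since a vertex at distance four would end an induced \<open>P\<^sub>5\<close>. If moreover \<open>b\<close> is a private
  neighbour of \<open>x\<close> and \<open>d\<close> a private neighbour of \<open>y\<close>, then \<open>b, x, c, y, d\<close> is an induced \<open>P\<^sub>5\<close>.
  Hence the neighbourhoods of the vertices of one part form a chain, and degrees decide the
  direction of the inclusions.
\<close>

lemma bipartition_commute: "bipartition G A B \<Longrightarrow> bipartition G B A"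
  by (auto simp: bipartition_def)

lemma bipartition_arcD:
  assumes "bipartition G A B" "(x, y) \<in> parcs G"
  shows "x \<in> A \<longleftrightarrow> y \<in> B" "x \<in> B \<longleftrightarrow> y \<in> A"
  using assms by (auto simp: bipartition_def)

context pair_graph
begin

text \<open>Since arcs join opposite parts, a path on \<open>a, b, c, d, e\<close> has only two
  candidate chords, \<open>ad\<close> and \<open>be\<close>. The walk need not be a path, which lets
  the lemma apply to walks with repeated vertices.\<close>

lemma P5_free_chord:
  assumes "P5_free G" "bipartition G A B" "a \<in> A"
    and arcs: "(a, b) \<in> parcs G" "(b, c) \<in> parcs G" "(c, d) \<in> parcs G" "(d, e) \<in> parcs G"
  shows "(a, d) \<in> parcs G \<or> (b, e) \<in> parcs G"
proof (rule ccontr)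
  assume no: "\<not> ?thesis"
  have no': "(d, a) \<notin> parcs G" "(e, b) \<notin> parcs G"
    using no arcs_symmetric by blast+
  have disj: "A \<inter> B = {}"
    using assms(2) by (simp add: bipartition_def)
  have parts: "b \<in> B" "c \<in> A" "d \<in> B" "e \<in> A"
    using arcs \<open>a \<in> A\<close> bipartition_arcD[OF assms(2)] by blast+
  have nonarc: "(x, y) \<notin> parcs G" if "x \<in> A \<and> y \<in> A \<or> x \<in> B \<and> y \<in> B" for x y
    using that bipartition_arcD[OF assms(2), of x y] disj by blast
  \<comment> \<open>Any coincidence within a part yields an excluded arc: \<open>a = c\<close> gives
    \<open>(a, d)\<close>, \<open>b = d\<close> and \<open>c = e\<close> give \<open>(b, e)\<close>,
    and \<open>a = e\<close> gives \<open>(a, d)\<close> by symmetry.\<close>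
  have "distinct [a, b, c, d, e]"
    using parts disj no no' arcs \<open>a \<in> A\<close> arcs_symmetric[OF arcs(4)] by auto
  moreover have "set [a, b, c, d, e] \<subseteq> pverts G"
    using arcs by (auto dest: in_arcsD1 in_arcsD2)
  ultimately have "vpath [a, b, c, d, e] (with_proj G)"
    using arcs by (auto simp: vpath_def vwalk_def)
  then have "induced_path G [a, b, c, d, e]"
    using parts \<open>a \<in> A\<close> no no' by (simp add: induced_path_def nonarc)
  moreover have "length [a, b, c, d, e] = 5"
    by simp
  ultimately show False
    using \<open>P5_free G\<close> unfolding P5_free_def by blast
qed

lemma P5_free_common_neighbour:
  assumes P5: "P5_free G" and bip: "bipartition G A B"
    and conn: "Digraph_Component.connected (with_proj G)"
    and x: "x \<in> A" "(x, b) \<in> parcs G" and y: "y \<in> A"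
  obtains c where "(x, c) \<in> parcs G" "(c, y) \<in> parcs G"
proof -
  \<comment> \<open>\<open>D\<close> holds the ends of walks of length two from \<open>x\<close>;
    the arc to \<open>b\<close> puts \<open>x\<close> itself in \<open>D\<close>.\<close>
  define D where "D = {z. \<exists>c. (x, c) \<in> parcs G \<and> (c, z) \<in> parcs G}"
  have "x \<rightarrow>\<^sup>*\<^bsub>with_proj G\<^esub> y"
    using symmetric_connected_imp_strongly_connected[OF pair_sym_arcs conn] x y bip
    by (auto simp: strongly_connected_def bipartition_def)
  then have "y \<in> D \<or> (\<exists>d \<in> D. (d, y) \<in> parcs G)"
  proof (induction rule: reachable_induct)
    case base
    then show ?case
      using x arcs_symmetric by (auto simp: D_def)
  next
    case (step z w)
    then have zw: "(z, w) \<in> parcs G"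
      by simp
    show ?case
    proof (cases "z \<in> D")
      case True
      then show ?thesis
        using zw by blast
    next
      case False
      then obtain c d where "(x, c) \<in> parcs G" "(c, d) \<in> parcs G" "(d, z) \<in> parcs G"
        using step.IH by (auto simp: D_def)
      \<comment> \<open>Either arc leads back into \<open>D\<close>: \<open>w\<close> is reached
        from \<open>x\<close> via \<open>z\<close> or via \<open>c\<close>.\<close>
      with zw have "(x, z) \<in> parcs G \<or> (c, w) \<in> parcs G"
        using P5_free_chord[OF P5 bip x(1)] by blast
      then show ?thesis
        using zw \<open>(x, c) \<in> parcs G\<close> by (auto simp: D_def)
    qed
  qed
  moreover have "D \<subseteq> A"
    using x(1) bipartition_arcD[OF bip] by (auto simp: D_def)
  \<comment> \<open>A neighbour of \<open>D\<close> lies in \<open>B\<close>, so \<open>y\<close>,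
    being in \<open>A\<close>, falls under the first alternative.\<close>
  ultimately have "y \<in> D"
    using bip y bipartition_arcD[OF bip] by (auto simp: bipartition_def)
  then show ?thesis
    using that by (auto simp: D_def)
qed

lemma P5_free_nbhd_chain:
  assumes P5: "P5_free G" and bip: "bipartition G A B"
    and conn: "Digraph_Component.connected (with_proj G)"
    and "x \<in> A" "y \<in> A"
  shows "nbhd G x \<subseteq> nbhd G y \<or> nbhd G y \<subseteq> nbhd G x"
proof (rule ccontr)
  assume "\<not> ?thesis"
  then obtain b d where b: "(x, b) \<in> parcs G" "(y, b) \<notin> parcs G"
    and d: "(y, d) \<in> parcs G" "(x, d) \<notin> parcs G"
    by (auto simp: nbhd_def)
  obtain c where c: "(x, c) \<in> parcs G" "(c, y) \<in> parcs G"
    using P5_free_common_neighbour[OF P5 bip conn \<open>x \<in> A\<close> b(1) \<open>y \<in> A\<close>] .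
  have "b \<in> B"
    using b(1) \<open>x \<in> A\<close> bip by (auto simp: bipartition_def)
  \<comment> \<open>The walk \<open>b, x, c, y, d\<close> starts in \<open>B\<close>, hence the
    exchange of the parts.\<close>
  then have "(b, y) \<in> parcs G \<or> (x, d) \<in> parcs G"
    using P5_free_chord[OF P5 bipartition_commute[OF bip]] arcs_symmetric[OF b(1)] c d(1) by blast
  then show False
    using b d arcs_symmetric by blast
qed

lemma P5_free_nbhd_mono:
  assumes "P5_free G" "bipartition G A B" "Digraph_Component.connected (with_proj G)"
    and "x \<in> A" "y \<in> A" and le: "deg G x \<le> deg G y"
  shows "nbhd G x \<subseteq> nbhd G y"
proof -
  have "finite (nbhd G x)"
    using pair_finite_verts by (simp add: nbhd_def)
  \<comment> \<open>If the chain goes the other way, the degree bound and finiteness force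
    equality.\<close>
  then show ?thesis
    using P5_free_nbhd_chain[OF assms(1-5)] le card_seteq unfolding deg_def by blast
qed

lemma P5_free_nbhd_mono_enum:
  fixes f :: "nat \<Rightarrow> 'a"
  assumes G: "P5_free G" "bipartition G A B" "Digraph_Component.connected (with_proj G)"
    and f: "f ` {1..n} \<subseteq> A"
    and le: "\<forall>i\<in>{1..<n}. deg G (f i) \<le> deg G (f (i + 1))"
  shows "\<forall>i\<in>{1..<n}. nbhd G (f i) \<subseteq> nbhd G (f (i + 1))"
proof
  fix i assume i: "i \<in> {1..<n}"
  then have "f i \<in> A" "f (i + 1) \<in> A"
    using f by (auto simp: image_subset_iff)
  then show "nbhd G (f i) \<subseteq> nbhd G (f (i + 1))"
    using P5_free_nbhd_mono[OF G] le i by blast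
qed

end

theorem theorem1:
  fixes G :: "'a pair_pre_digraph"
    and A B A1 B1 A2 B2 :: "'a set"
    and u v :: "nat \<Rightarrow> 'a"
    and p q :: nat
  assumes "pair_graph G"
    and "Digraph_Component.connected (with_proj G)"
    and "P5_free G"
    and "chordal_bipartite G"
    and "bipartition G A B"
    and "maximum_biclique G A B A1 B1"
    and "A2 = A - A1"
    and "B2 = B - B1"
    and "bij_betw u {1..p} A2"
    and "bij_betw v {1..q} B2"
  shows "((\<forall>i\<in>{1..<p}. deg G (u i) \<le> deg G (u (i + 1))) \<longrightarrow>
            (\<forall>i\<in>{1..<p}. nbhd G (u i) \<subseteq> nbhd G (u (i + 1)))) \<and>
         ((\<forall>j\<in>{1..<q}. deg G (v j) \<le> deg G (v (j + 1))) \<longrightarrow>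
            (\<forall>j\<in>{1..<q}. nbhd G (v j) \<subseteq> nbhd G (v (j + 1))))"
proof -
  interpret pair_graph G by fact
  have "u ` {1..p} \<subseteq> A" "v ` {1..q} \<subseteq> B"
    using assms(7-10) by (auto simp: bij_betw_def)
  then show ?thesis
    \<comment> \<open>The claim on \<open>v\<close> is the claim on \<open>u\<close> with
      \<open>A\<close> and \<open>B\<close> exchanged.\<close>
    by (intro conjI impI P5_free_nbhd_mono_enum[OF assms(3,5,2)]
        P5_free_nbhd_mono_enum[OF assms(3) bipartition_commute[OF assms(5)] assms(2)])
qed

end
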